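(* Let $m\ge2$ and $2p\ge m$. Assume that the sequence of knots $T$ satisfies, for all $i\in\mathbb{Z}$, $$\theta_{i-1}+\theta_i\le\theta_{i-p}+\theta_{i+p}\le\theta_i+\theta_{i+1}.$$ Then, for all $i\in\mathbb{Z}$, $a_i^*$ is an optimal solution of the local minimization problem $$(M_i)\qquad \min\{\Vert a\Vert_1 \;:\; a\in\mathbb{R}^{2p+1},\ V_ia=b_i\}.$$ Thus, for all $p\ge m$ (and $T$ satisfying, for this $p$, $\theta_{i-1}+\theta_i\le\theta_{i-p}+\theta_{i+p}\le\theta_i+\theta_{i+1}$ for all $i\in\mathbb{Z}$), the spline discrete quasi-interpolant $Q_p^*$ is near-best.
   Context: $T=\{t_i\}_{i\in\mathbb{Z}}$ is a strictly increasing sequence of real knots with $|t_i|\to+\infty$ as $|i|\to+\infty$. $B_i$ ($i\in\mathbb{Z}$) is the B-spline of degree $m$ with support $[t_{i-m},t_{i+1}]$, normalized so that $\sum_iB_i=1$. Set $$\theta_i=\frac1m\sum_{r=1}^m t_{i+1-r},\qquad \theta_i^{(2)}=\frac{2}{m(m-1)}\sum_{1\le r<s\le m}t_{i+1-r}t_{i+1-s},\qquad \bar\theta_i^{(2)}=\theta_i^2-\theta_i^{(2)}.$$ Vectors $a\in\mathbb{R}^{2p+1}$ are indexed as $(a(s))_{-p\le s\le p}$, and $\Vert a\Vert_1=\sum_s|a(s)|$. The matrix $V_i\in\mathbb{R}^{3\times(2p+1)}$ has entries $V_i(r,s)=\theta_{i+s}^r$, $r=0,1,2$, $-p\le s\le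 p$, and $b_i=(1,\theta_i,\theta_i^{(2)})^T$. The constraints $V_ia_i=b_i$ for all $i$ express that the operator $Qf=\sum_{i}\big(\sum_{s=-p}^p a_i(s)f(\theta_{i+s})\big)B_i$ reproduces polynomials of degree at most $2$. The vector $a_i^*\in\mathbb{R}^{2p+1}$ has $a_i^*(s)=0$ for $s\notin\{-p,0,p\}$ and $$a_i^*(-p)=-\frac{\bar\theta_i^{(2)}}{(\theta_{i+p}-\theta_{i-p})(\theta_i-\theta_{i-p})},\quad a_i^*(0)=1+\frac{\bar\theta_i^{(2)}}{(\theta_{i+p}-\theta_i)(\theta_i-\theta_{i-p})},\quad a_i^*(p)=-\frac{\bar\theta_i^{(2)}}{(\theta_{i+p}-\theta_{i-p})(\theta_{i+p}-\theta_i)},$$ and $Q_p^*f=\sum_{i\in\mathbb{Z}}\big(a_i^*(-p)f(\theta_{i-p})+a_i^*(0)f(\theta_i)+a_i^*(p)f(\theta_{i+p})\big)B_i$. An operator $Qf=\sum_i\big(\sum_{s=-p}^p a_i(s)f(\theta_{i+s})\big)B_i$ reproducing polynomials of degree at most $2$ is called near-best if, for every $i\in\mathbb{Z}$, its coefficient vector $a_i$ is a solution of the minimization problem $(M_i)$: $\min\{\Vert a\Vert_1 : a\in\mathbb{R}^{2p+1},\ V_ia=b_i\}$. *)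

theory Defs
  imports "HOL-Analysis.Analysis" "HOL-Computational_Algebra.Polynomial"
begin

(* The filter  filtercomap abs at_top  on the integers expresses  |i| \<rightarrow> \<infinity>. *)
definition knot_sequence :: "(int \<Rightarrow> real) \<Rightarrow> bool" where
  "knot_sequence t \<longleftrightarrow>
     strict_mono t \<and> filterlim (\<lambda>i. \<bar>t i\<bar>) at_top (filtercomap abs at_top)"

(* Cox-de Boor recurrence:  cox_de_boor t k j  is the B-spline of degree k on the knots
   t j, ..., t (j + k + 1), normalized so that the B-splines of degree k sum to 1.
   The index is that of the leftmost knot. *)
primrec cox_de_boor :: "(int \<Rightarrow> real) \<Rightarrow> nat \<Rightarrow> int \<Rightarrow> real \<Rightarrow> real" where
  "cox_de_boor t 0 j x = (if t j \<le> x \<and> x < t (j + 1) then 1 else 0)"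
| "cox_de_boor t (Suc k) j x =
     (x - t j) / (t (j + int (Suc k)) - t j) * cox_de_boor t k j x
     + (t (j + int (Suc k) + 1) - x) / (t (j + int (Suc k) + 1) - t (j + 1))
         * cox_de_boor t k (j + 1) x"

(* Shifted indexing:  bspline t m i  has support {t (i - m)..t (i + 1)}. *)
definition bspline :: "(int \<Rightarrow> real) \<Rightarrow> nat \<Rightarrow> int \<Rightarrow> real \<Rightarrow> real" where
  "bspline t m i = cox_de_boor t m (i - int m)"

definition theta :: "(int \<Rightarrow> real) \<Rightarrow> nat \<Rightarrow> int \<Rightarrow> real" where
  "theta t m i = (1 / real m) * (\<Sum>r = 1..m. t (i + 1 - int r))"

definition theta2 :: "(int \<Rightarrow> real) \<Rightarrow> nat \<Rightarrow> int \<Rightarrow> real" where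
  "theta2 t m i = 2 / (real m * (real m - 1))
     * (\<Sum>r = 1..m. \<Sum>s \<in> {r<..m}. t (i + 1 - int r) * t (i + 1 - int s))"

definition theta2_bar :: "(int \<Rightarrow> real) \<Rightarrow> nat \<Rightarrow> int \<Rightarrow> real" where
  "theta2_bar t m i = (theta t m i)\<^sup>2 - theta2 t m i"

(* The space of real vectors (a(s)) with -p \<le> s \<le> p, of dimension 2p+1, is modelled by
   the functions on the integers that vanish outside {-p..p}. *)
definition vecs :: "nat \<Rightarrow> (int \<Rightarrow> real) set" where
  "vecs p = {a. \<forall>s. s \<notin> {- int p..int p} \<longrightarrow> a s = 0}"

definition norm1 :: "nat \<Rightarrow> (int \<Rightarrow> real) \<Rightarrow> real" where
  "norm1 p a = (\<Sum>s = - int p..int p. \<bar>a s\<bar>)"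

definition V :: "(int \<Rightarrow> real) \<Rightarrow> nat \<Rightarrow> int \<Rightarrow> nat \<Rightarrow> int \<Rightarrow> real" where
  "V t m i r s = theta t m (i + s) ^ r"

definition b :: "(int \<Rightarrow> real) \<Rightarrow> nat \<Rightarrow> int \<Rightarrow> nat \<Rightarrow> real" where
  "b t m i r = [1, theta t m i, theta2 t m i] ! r"

definition feasible :: "(int \<Rightarrow> real) \<Rightarrow> nat \<Rightarrow> nat \<Rightarrow> int \<Rightarrow> (int \<Rightarrow> real) \<Rightarrow> bool" where
  "feasible t m p i a \<longleftrightarrow>
     a \<in> vecs p \<and>
     (\<forall>r \<in> {0, 1, 2}. (\<Sum>s = - int p..int p. V t m i r s * a s) = b t m i r)"

definition optimal :: "(int \<Rightarrow> real) \<Rightarrow> nat \<Rightarrow> nat \<Rightarrow> int \<Rightarrow> (int \<Rightarrow> real) \<Rightarrow> bool" where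
  "optimal t m p i a \<longleftrightarrow> is_arg_min (norm1 p) (feasible t m p i) a"

(* For every x only finitely many of the summands are nonzero. *)
definition quasi_interpolant ::
    "(int \<Rightarrow> real) \<Rightarrow> nat \<Rightarrow> nat \<Rightarrow> (int \<Rightarrow> int \<Rightarrow> real) \<Rightarrow> (real \<Rightarrow> real) \<Rightarrow> real \<Rightarrow> real" where
  "quasi_interpolant t m p a f x =
     (\<Sum>\<^sub>\<infinity>i. (\<Sum>s = - int p..int p. a i s * f (theta t m (i + s))) * bspline t m i x)"

definition reproduces_quadratics :: "((real \<Rightarrow> real) \<Rightarrow> real \<Rightarrow> real) \<Rightarrow> bool" where
  "reproduces_quadratics Q \<longleftrightarrow> (\<forall>q :: real poly. degree q \<le> 2 \<longrightarrow> Q (poly q) = poly q)"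

(* near_best t m p a Q:  Q is the discrete quasi-interpolant with coefficient vectors a i,
   and it is near-best. *)
definition near_best ::
    "(int \<Rightarrow> real) \<Rightarrow> nat \<Rightarrow> nat \<Rightarrow> (int \<Rightarrow> int \<Rightarrow> real) \<Rightarrow> ((real \<Rightarrow> real) \<Rightarrow> real \<Rightarrow> real) \<Rightarrow> bool"
  where
  "near_best t m p a Q \<longleftrightarrow>
     Q = quasi_interpolant t m p a \<and>
     reproduces_quadratics Q \<and>
     (\<forall>i. optimal t m p i (a i))"

definition a_star :: "(int \<Rightarrow> real) \<Rightarrow> nat \<Rightarrow> nat \<Rightarrow> int \<Rightarrow> int \<Rightarrow> real" where
  "a_star t m p i s =
     (let u = theta t m (i - int p); v = theta t m i; w = theta t m (i + int p);
          d = theta2_bar t m i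
      in if s = - int p then - d / ((w - u) * (v - u))
         else if s = 0 then 1 + d / ((w - v) * (v - u))
         else if s = int p then - d / ((w - u) * (w - v))
         else 0)"

definition Q_star ::
    "(int \<Rightarrow> real) \<Rightarrow> nat \<Rightarrow> nat \<Rightarrow> (real \<Rightarrow> real) \<Rightarrow> real \<Rightarrow> real" where
  "Q_star t m p f x =
     (\<Sum>\<^sub>\<infinity>i. (a_star t m p i (- int p) * f (theta t m (i - int p))
            + a_star t m p i 0 * f (theta t m i)
            + a_star t m p i (int p) * f (theta t m (i + int p))) * bspline t m i x)"

definition knot_condition :: "(int \<Rightarrow> real) \<Rightarrow> nat \<Rightarrow> nat \<Rightarrow> bool" where
  "knot_condition t m p \<longleftrightarrow>
     (\<forall>i. theta t m (i - 1) + theta t m i \<le> theta t m (i - int p) + theta t m (i + int p) \<and>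
          theta t m (i - int p) + theta t m (i + int p) \<le> theta t m i + theta t m (i + 1))"

end

theory Submission
  imports Defs
begin

text \<open>
  \<^bold>\<open>Optimality\<close> is linear programming duality.  Write \<open>\<theta>\<close> and \<open>\<theta>2\<close> for \<open>theta t m\<close> and
  \<open>theta2 t m\<close>, and put \<open>u = \<theta>(i - p)\<close>, \<open>v = \<theta>(i)\<close>, \<open>w = \<theta>(i + p)\<close>.  By Cauchy--Schwarz
  \<open>d = v\<^sup>2 - \<theta>2(i)\<close> is nonnegative, so the entries of the candidate at \<open>u, v, w\<close> are
  \<open>\<le> 0\<close>, \<open>\<ge> 0\<close>, \<open>\<le> 0\<close>; they are the weights of point evaluation at \<open>v\<close> minus \<open>d\<close> times the
  second divided difference, whence feasibility.  The parabola \<open>q\<close> with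
  \<open>q(u) = q(w) = -1\<close> and \<open>q(v) = 1\<close> is symmetric about \<open>(u + w)/2\<close>.  The knot condition says
  exactly that no node \<open>\<theta>(i + s)\<close> is nearer to this axis than \<open>v\<close>, so \<open>\<bar>q\<bar> \<le> 1\<close> at all
  nodes with \<open>\<bar>s\<bar> \<le> p\<close>.
  Every feasible \<open>a\<close> yields the same value \<open>\<Sum>\<^sub>s q(\<theta>(i + s)) a(s)\<close>; that value is at most
  \<open>\<parallel>a\<parallel>\<^sub>1\<close>, and it is the norm of the candidate because the signs match
  (\<open>optimal_if_dual_certificate\<close>).

  \<^bold>\<open>Reproduction of quadratics\<close> follows from Marsden's identity in the form
  \<open>\<Sum>\<^sub>i B\<^sub>i(x) \<Prod>\<^sub>r (1 + z t(i + 1 - r)) = (1 + z x)\<^sup>m\<close> (\<open>marsden_identity\<close>), which is proved by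
  induction on the degree from the Cox--de Boor recurrence.  Comparing the coefficients of
  \<open>1, z, z\<^sup>2\<close> expresses \<open>1, x, x\<^sup>2\<close> as the B-spline series with coefficients
  \<open>1, \<theta>(i), \<theta>2(i)\<close>, and these are the moments prescribed by the constraints.
\<close>

section \<open>Elementary symmetric sums of degree two\<close>

lemma sum_pairs_Suc:
  fixes f :: "nat \<Rightarrow> 'a::comm_ring_1"
  shows "(\<Sum>r = 1..Suc k. \<Sum>s \<in> {r<..Suc k}. f r * f s) =
         (\<Sum>r = 1..k. \<Sum>s \<in> {r<..k}. f r * f s) + (\<Sum>r = 1..k. f r) * f (Suc k)"
proof -
  have "(\<Sum>s \<in> {r<..Suc k}. f r * f s) = (\<Sum>s \<in> {r<..k}. f r * f s) + f r * f (Suc k)"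
    if "r \<in> {1..k}" for r
  proof -
    have "{r<..Suc k} = insert (Suc k) {r<..k}"
      using that by auto
    then show ?thesis
      by (simp add: add.commute)
  qed
  then show ?thesis
    by (simp add: sum.distrib sum_distrib_right)
qed

lemma two_sum_pairs:
  fixes f :: "nat \<Rightarrow> 'a::comm_ring_1"
  shows "2 * (\<Sum>r = 1..k. \<Sum>s \<in> {r<..k}. f r * f s) =
         (\<Sum>r = 1..k. f r)\<^sup>2 - (\<Sum>r = 1..k. (f r)\<^sup>2)"
proof (induction k)
  case 0
  show ?case by simp
next
  case (Suc k)
  show ?case
    unfolding sum_pairs_Suc distrib_left Suc.IH
    by (simp add: power2_eq_square algebra_simps)
qed

lemma coeff_prod_linear:
  fixes f :: "nat \<Rightarrow> 'a::comm_ring_1"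
  shows "coeff (\<Prod>r = 1..k. [:1, f r:]) 0 = 1"
    and "coeff (\<Prod>r = 1..k. [:1, f r:]) 1 = (\<Sum>r = 1..k. f r)"
    and "coeff (\<Prod>r = 1..k. [:1, f r:]) 2 = (\<Sum>r = 1..k. \<Sum>s \<in> {r<..k}. f r * f s)"
proof -
  have "coeff (\<Prod>r = 1..k. [:1, f r:]) 0 = 1 \<and>
        coeff (\<Prod>r = 1..k. [:1, f r:]) 1 = (\<Sum>r = 1..k. f r) \<and>
        coeff (\<Prod>r = 1..k. [:1, f r:]) 2 = (\<Sum>r = 1..k. \<Sum>s \<in> {r<..k}. f r * f s)"
  proof (induction k)
    case 0
    show ?case by simp
  next
    case (Suc k)
    have "(\<Prod>r = 1..Suc k. [:1, f r:]) =
          (\<Prod>r = 1..k. [:1, f r:]) + smult (f (Suc k)) (pCons 0 (\<Prod>r = 1..k. [:1, f r:]))"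
      by (simp add: mult.commute)
    with Suc.IH show ?case
      unfolding sum_pairs_Suc
      by (simp add: numeral_2_eq_2 mult.commute)
  qed
  then show "coeff (\<Prod>r = 1..k. [:1, f r:]) 0 = 1"
    and "coeff (\<Prod>r = 1..k. [:1, f r:]) 1 = (\<Sum>r = 1..k. f r)"
    and "coeff (\<Prod>r = 1..k. [:1, f r:]) 2 = (\<Sum>r = 1..k. \<Sum>s \<in> {r<..k}. f r * f s)"
    by blast+
qed

section \<open>Marsden's identity\<close>

text \<open>In the shifted indexing the Cox--de Boor recurrence involves the splines of index \<open>i - 1\<close>
  and \<open>i\<close>.\<close>

lemma bspline_Suc:
  "bspline t (Suc k) i x =
     (x - t (i - int k - 1)) / (t i - t (i - int k - 1)) * bspline t k (i - 1) x
     + (t (i + 1) - x) / (t (i + 1) - t (i - int k)) * bspline t k i x"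
  by (simp add: bspline_def algebra_simps)

lemma bspline_eq_0_outside:
  assumes "strict_mono t" and "t n \<le> x" "x < t (n + 1)" and "i \<notin> {n..n + int k}"
  shows "bspline t k i x = 0"
  using assms(4)
proof (induction k arbitrary: i)
  case 0
  have "\<not> (t i \<le> x \<and> x < t (i + 1))"
  proof
    assume *: "t i \<le> x \<and> x < t (i + 1)"
    then have "t i < t (n + 1)" "t n < t (i + 1)"
      using assms(2,3) by linarith+
    then have "i < n + 1" "n < i + 1"
      using assms(1) by (simp_all add: strict_mono_less)
    with 0 show False by simp
  qed
  then show ?case
    by (simp add: bspline_def)
next
  case (Suc k)
  have "i - 1 \<notin> {n..n + int k}" "i \<notin> {n..n + int k}"
    using Suc.prems by auto
  then show ?case
    by (simp add: bspline_Suc Suc.IH)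
qed

text \<open>Both sides are polynomials in the auxiliary variable \<open>z\<close>.  Only the \<open>k + 1\<close> splines whose
  support contains the knot interval of \<open>x\<close> enter the sum.\<close>

theorem marsden_identity:
  fixes t :: "int \<Rightarrow> real"
  assumes mono: "strict_mono t" and x: "t n \<le> x" "x < t (n + 1)"
  shows "(\<Sum>i = n..n + int k. smult (bspline t k i x) (\<Prod>r = 1..k. [:1, t (i + 1 - int r):]))
         = [:1, x:] ^ k"
proof (induction k)
  case 0
  show ?case using x by (simp add: bspline_def)
next
  case (Suc k)
  define P where "P k i = (\<Prod>r = 1..k. [:1, t (i + 1 - int r):])" for k i
  define L where "L i = (x - t (i - int k)) / (t (i + 1) - t (i - int k))" for i
  define R where "R i = (t (i + 1) - x) / (t (i + 1) - t (i - int k))" for i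
  \<comment> \<open>Both products of length \<open>k + 1\<close> that multiply a given spline of degree \<open>k\<close> extend the same
      product of length \<open>k\<close>, one to the right and one to the left.\<close>
  have P_right: "P (Suc k) (i + 1) = [:1, t (i + 1):] * P k i" for i
  proof -
    have "P (Suc k) (i + 1) = (\<Prod>r = Suc 0..Suc k. [:1, t (i + 2 - int r):])"
      by (simp add: P_def algebra_simps)
    also have "\<dots> = [:1, t (i + 1):] * (\<Prod>r = Suc (Suc 0)..Suc k. [:1, t (i + 2 - int r):])"
      by (subst prod.atLeast_Suc_atMost) (simp_all add: add.commute)
    also have "(\<Prod>r = Suc (Suc 0)..Suc k. [:1, t (i + 2 - int r):]) = P k i"
      by (subst prod.shift_bounds_cl_Suc_ivl) (simp add: P_def algebra_simps)
    finally show ?thesis .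
  qed
  have P_left: "P (Suc k) i = [:1, t (i - int k):] * P k i" for i
    by (simp add: P_def algebra_simps)
  have vanish: "bspline t k i x = 0" if "i \<notin> {n..n + int k}" for i
    using bspline_eq_0_outside[OF mono x that] .
  have combine: "smult (L i) (P (Suc k) (i + 1)) + smult (R i) (P (Suc k) i) = [:1, x:] * P k i"
    for i
  proof -
    have "t (i - int k) < t (i + 1)"
      using mono by (simp add: strict_mono_less)
    then have "L i + R i = 1" "L i * t (i + 1) + R i * t (i - int k) = x"
      by (simp_all add: L_def R_def divide_simps) (simp_all add: algebra_simps)
    then have "smult (L i) [:1, t (i + 1):] + smult (R i) [:1, t (i - int k):] = [:1, x:]"
      by simp
    then show ?thesis
      unfolding P_right P_left[of i] by (simp only: mult_smult_left[symmetric] distrib_right[symmetric])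
  qed
  have "(\<Sum>i = n..n + int (Suc k). smult (bspline t (Suc k) i x) (P (Suc k) i)) =
        (\<Sum>i = n..n + int (Suc k). smult (L (i - 1) * bspline t k (i - 1) x) (P (Suc k) i)) +
        (\<Sum>i = n..n + int (Suc k). smult (R i * bspline t k i x) (P (Suc k) i))"
  proof -
    have "bspline t (Suc k) i x = L (i - 1) * bspline t k (i - 1) x + R i * bspline t k i x" for i
      by (simp add: bspline_Suc L_def R_def algebra_simps)
    then show ?thesis
      by (simp only: smult_add_left sum.distrib)
  qed
  also have "(\<Sum>i = n..n + int (Suc k). smult (L (i - 1) * bspline t k (i - 1) x) (P (Suc k) i)) =
        (\<Sum>i = n - 1..n + int k. smult (L i * bspline t k i x) (P (Suc k) (i + 1)))"
    by (rule sum.reindex_bij_witness[where i = "\<lambda>i. i + 1" and j = "\<lambda>i. i - 1"]) auto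
  also have "\<dots> = (\<Sum>i = n..n + int k. smult (L i * bspline t k i x) (P (Suc k) (i + 1)))"
    by (rule sum.mono_neutral_right) (auto simp: vanish)
  also have "(\<Sum>i = n..n + int (Suc k). smult (R i * bspline t k i x) (P (Suc k) i)) =
        (\<Sum>i = n..n + int k. smult (R i * bspline t k i x) (P (Suc k) i))"
    by (rule sum.mono_neutral_right) (auto simp: vanish)
  also have "(\<Sum>i = n..n + int k. smult (L i * bspline t k i x) (P (Suc k) (i + 1))) +
        (\<Sum>i = n..n + int k. smult (R i * bspline t k i x) (P (Suc k) i)) =
        (\<Sum>i = n..n + int k. smult (bspline t k i x)
            (smult (L i) (P (Suc k) (i + 1)) + smult (R i) (P (Suc k) i)))"
    by (simp add: sum.distrib[symmetric] smult_add_right mult.commute)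
  also have "\<dots> = [:1, x:] * (\<Sum>i = n..n + int k. smult (bspline t k i x) (P k i))"
    unfolding combine sum_distrib_left by (simp add: mult_smult_right)
  also have "\<dots> = [:1, x:] ^ Suc k"
    using Suc.IH by (simp add: P_def)
  finally show ?case
    by (simp add: P_def)
qed

lemma obtain_knot_interval:
  assumes "knot_sequence t"
  obtains n where "t n \<le> x" "x < t (n + 1)"
proof -
  have mono: "strict_mono t" and lim: "filterlim (\<lambda>i. \<bar>t i\<bar>) at_top (filtercomap abs at_top)"
    using assms by (auto simp: knot_sequence_def)
  have "\<forall>\<^sub>F i in filtercomap abs at_top. \<bar>t i\<bar> > \<bar>x\<bar> + \<bar>t 0\<bar>"
    using lim by (simp add: filterlim_at_top_dense)
  then obtain M :: int where M: "\<And>i. \<bar>i\<bar> \<ge> M \<Longrightarrow> \<bar>t i\<bar> > \<bar>x\<bar> + \<bar>t 0\<bar>"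
    by (auto simp: eventually_filtercomap eventually_at_top_linorder)
  define N where "N = max M 0"
  have N: "N \<ge> 0" "\<bar>t N\<bar> > \<bar>x\<bar> + \<bar>t 0\<bar>" "\<bar>t (- N)\<bar> > \<bar>x\<bar> + \<bar>t 0\<bar>"
  proof -
    have "\<bar>N\<bar> \<ge> M" "\<bar>- N\<bar> \<ge> M"
      by (simp_all add: N_def)
    then show "\<bar>t N\<bar> > \<bar>x\<bar> + \<bar>t 0\<bar>" "\<bar>t (- N)\<bar> > \<bar>x\<bar> + \<bar>t 0\<bar>"
      by (blast intro: M)+
    show "N \<ge> 0"
      by (simp add: N_def)
  qed
  have "t 0 \<le> t N" "t (- N) \<le> t 0"
    using mono N(1) by (simp_all add: strict_mono_less_eq)
  with N have bounds: "x < t N" "t (- N) \<le> x"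
    by linarith+
  define A where "A = {i \<in> {- N..N}. t i \<le> x}"
  have "finite A"
    by (rule finite_subset[of _ "{- N..N}"]) (auto simp: A_def)
  moreover have "- N \<in> A"
    using bounds N(1) by (simp add: A_def)
  ultimately have A: "finite A" "A \<noteq> {}"
    by auto
  define n where "n = Max A"
  have "n \<in> A"
    using A by (simp add: n_def)
  have "n + 1 \<notin> A"
    using A Max_ge[of A "n + 1"] by (auto simp: n_def)
  have "n \<noteq> N"
    using \<open>n \<in> A\<close> bounds by (auto simp: A_def)
  with \<open>n \<in> A\<close> \<open>n + 1 \<notin> A\<close> have "t n \<le> x" "x < t (n + 1)"
    by (auto simp: A_def)
  then show thesis
    by (rule that)
qed

text \<open>The coefficients of \<open>1\<close>, \<open>z\<close> and \<open>z\<^sup>2\<close> in Marsden's identity.  The right-hand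
  side is itself a product of linear factors, with all knots replaced by \<open>x\<close>.\<close>

lemma bspline_moments:
  assumes mono: "strict_mono t" and m: "m \<ge> 2" and x: "t n \<le> x" "x < t (n + 1)"
  shows "(\<Sum>i = n..n + int m. bspline t m i x) = 1"
    and "(\<Sum>i = n..n + int m. theta t m i * bspline t m i x) = x"
    and "(\<Sum>i = n..n + int m. theta2 t m i * bspline t m i x) = x\<^sup>2"
proof -
  define e2 where "e2 f = (\<Sum>r = 1..m. \<Sum>s \<in> {r<..m}. f r * f s)" for f :: "nat \<Rightarrow> real"
  have "(\<Sum>i = n..n + int m. smult (bspline t m i x) (\<Prod>r = 1..m. [:1, t (i + 1 - int r):]))
        = (\<Prod>r = 1..m. [:1, x:])"
    using marsden_identity[OF mono x, of m] by simp
  then have coeffs: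
    "(\<Sum>i = n..n + int m. bspline t m i x * coeff (\<Prod>r = 1..m. [:1, t (i + 1 - int r):]) j)
     = coeff (\<Prod>r = 1..m. [:1, x:]) j" for j
    by (metis (no_types, lifting) coeff_smult coeff_sum sum.cong)
  show "(\<Sum>i = n..n + int m. bspline t m i x) = 1"
    using coeffs[of 0] unfolding coeff_prod_linear by simp
  have "(\<Sum>i = n..n + int m. bspline t m i x * (\<Sum>r = 1..m. t (i + 1 - int r))) = real m * x"
    using coeffs[of 1] unfolding coeff_prod_linear by simp
  then have "(1 / real m) *
      (\<Sum>i = n..n + int m. bspline t m i x * (\<Sum>r = 1..m. t (i + 1 - int r))) = x"
    using m by simp
  then show "(\<Sum>i = n..n + int m. theta t m i * bspline t m i x) = x"
    unfolding theta_def sum_distrib_left[of "1 / real m" _ "{n..n + int m}"]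
    by (simp only: mult.assoc mult.commute[of "bspline t m _ x"])
  have const: "e2 (\<lambda>_. x) = real m * (real m - 1) / 2 * x\<^sup>2"
    using two_sum_pairs[of "\<lambda>_. x" m]
    by (simp add: e2_def power2_eq_square algebra_simps)
  have "(\<Sum>i = n..n + int m. bspline t m i x * e2 (\<lambda>r. t (i + 1 - int r))) = e2 (\<lambda>_. x)"
    using coeffs[of 2] unfolding coeff_prod_linear e2_def .
  then have "2 / (real m * (real m - 1)) *
      (\<Sum>i = n..n + int m. bspline t m i x * e2 (\<lambda>r. t (i + 1 - int r))) = x\<^sup>2"
    using m unfolding \<open>_ = e2 (\<lambda>_. x)\<close> const by simp
  then show "(\<Sum>i = n..n + int m. theta2 t m i * bspline t m i x) = x\<^sup>2"
    unfolding theta2_def e2_def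
      sum_distrib_left[of "2 / (real m * (real m - 1))" _ "{n..n + int m}"]
    by (simp only: mult.assoc mult.commute[of "bspline t m _ x"])
qed

section \<open>Consequences of the constraints\<close>

lemma poly_degree_le_2:
  fixes q :: "'a::comm_ring_1 poly"
  assumes "degree q \<le> 2"
  shows "poly q x = coeff q 0 + coeff q 1 * x + coeff q 2 * x\<^sup>2"
proof -
  have "poly q x = (\<Sum>i\<le>2. coeff q i * x ^ i)"
    unfolding poly_altdef using assms
    by (intro sum.mono_neutral_left) (auto simp: coeff_eq_0)
  then show ?thesis
    by (simp add: numeral_2_eq_2)
qed

lemma feasible_poly:
  assumes "feasible t m p i a" and "degree q \<le> 2"
  shows "(\<Sum>s = - int p..int p. a s * poly q (theta t m (i + s))) =
         coeff q 0 + coeff q 1 * theta t m i + coeff q 2 * theta2 t m i"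
proof -
  have mom: "(\<Sum>s = - int p..int p. a s) = 1"
    "(\<Sum>s = - int p..int p. theta t m (i + s) * a s) = theta t m i"
    "(\<Sum>s = - int p..int p. (theta t m (i + s))\<^sup>2 * a s) = theta2 t m i"
    using assms(1) by (simp_all add: feasible_def V_def b_def)
  have "(\<Sum>s = - int p..int p. a s * poly q (theta t m (i + s))) =
        coeff q 0 * (\<Sum>s = - int p..int p. a s)
        + coeff q 1 * (\<Sum>s = - int p..int p. theta t m (i + s) * a s)
        + coeff q 2 * (\<Sum>s = - int p..int p. (theta t m (i + s))\<^sup>2 * a s)"
    unfolding poly_degree_le_2[OF assms(2)]
    by (simp add: sum_distrib_left sum.distrib algebra_simps)
  with mom show ?thesis by simp
qed

lemma feasible_imp_reproduces_quadratics:
  assumes knots: "knot_sequence t" and m: "m \<ge> 2" and feas: "\<And>i. feasible t m p i (a i)"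
  shows "reproduces_quadratics (quasi_interpolant t m p a)"
  unfolding reproduces_quadratics_def
proof (intro allI impI ext)
  fix q :: "real poly" and x :: real
  assume q: "degree q \<le> 2"
  have mono: "strict_mono t"
    using knots by (simp add: knot_sequence_def)
  obtain n where n: "t n \<le> x" "x < t (n + 1)"
    using obtain_knot_interval[OF knots] .
  let ?c = "\<lambda>i. coeff q 0 + coeff q 1 * theta t m i + coeff q 2 * theta2 t m i"
  have "quasi_interpolant t m p a (poly q) x = (\<Sum>\<^sub>\<infinity>i. ?c i * bspline t m i x)"
    by (simp add: quasi_interpolant_def feasible_poly[OF feas q])
  also have "\<dots> = (\<Sum>\<^sub>\<infinity>i\<in>{n..n + int m}. ?c i * bspline t m i x)"
    by (rule infsum_cong_neutral) (auto simp: bspline_eq_0_outside[OF mono n])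
  also have "\<dots> = (\<Sum>i = n..n + int m. ?c i * bspline t m i x)"
    by simp
  also have "\<dots> = coeff q 0 * (\<Sum>i = n..n + int m. bspline t m i x)
      + coeff q 1 * (\<Sum>i = n..n + int m. theta t m i * bspline t m i x)
      + coeff q 2 * (\<Sum>i = n..n + int m. theta2 t m i * bspline t m i x)"
    by (simp add: sum_distrib_left sum.distrib algebra_simps)
  also have "\<dots> = poly q x"
    by (simp add: bspline_moments[OF mono m n] poly_degree_le_2[OF q])
  finally show "quasi_interpolant t m p a (poly q) x = poly q x" .
qed

text \<open>Weak duality with equality: the quadratic \<open>q\<close> is feasible for the dual of the norm
  minimization, and hypothesis \<open>slack\<close> is complementary slackness.\<close>

lemma optimal_if_dual_certificate:
  assumes feas: "feasible t m p i a" and q: "degree q \<le> 2"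
    and bound: "\<And>s. s \<in> {- int p..int p} \<Longrightarrow> \<bar>poly q (theta t m (i + s))\<bar> \<le> 1"
    and slack: "\<And>s. s \<in> {- int p..int p} \<Longrightarrow> a s * poly q (theta t m (i + s)) = \<bar>a s\<bar>"
  shows "optimal t m p i a"
  unfolding optimal_def is_arg_min_linorder
proof (intro conjI allI impI)
  show "feasible t m p i a" by (fact feas)
next
  fix c assume c: "feasible t m p i c"
  have "norm1 p a = (\<Sum>s = - int p..int p. a s * poly q (theta t m (i + s)))"
    unfolding norm1_def by (intro sum.cong refl) (simp only: slack)
  also have "\<dots> = (\<Sum>s = - int p..int p. c s * poly q (theta t m (i + s)))"
    using feasible_poly[OF feas q] feasible_poly[OF c q] by simp
  also have "\<dots> \<le> (\<Sum>s = - int p..int p. \<bar>c s\<bar>)"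
  proof (rule sum_mono)
    fix s assume "s \<in> {- int p..int p}"
    then have "\<bar>c s\<bar> * \<bar>poly q (theta t m (i + s))\<bar> \<le> \<bar>c s\<bar> * 1"
      by (intro mult_left_mono bound) auto
    then show "c s * poly q (theta t m (i + s)) \<le> \<bar>c s\<bar>"
      by (simp add: abs_mult[symmetric])
  qed
  finally show "norm1 p a \<le> norm1 p c"
    by (simp add: norm1_def)
qed

section \<open>The three-point solution\<close>

lemma strict_mono_theta:
  assumes "strict_mono t" and "m > 0"
  shows "strict_mono (theta t m)"
proof (rule strict_monoI)
  fix i j :: int assume "i < j"
  then have "(\<Sum>r = 1..m. t (i + 1 - int r)) < (\<Sum>r = 1..m. t (j + 1 - int r))"
    using assms by (intro sum_strict_mono) (auto simp: strict_mono_less)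
  then show "theta t m i < theta t m j"
    using assms(2) by (simp add: theta_def divide_strict_right_mono)
qed

text \<open>The quantity is a nonnegative multiple of the variance of the knots involved.\<close>

lemma theta2_bar_nonneg:
  assumes m: "m \<ge> 2"
  shows "theta2_bar t m i \<ge> 0"
proof -
  define S where "S = (\<Sum>r = 1..m. t (i + 1 - int r))"
  define Q where "Q = (\<Sum>r = 1..m. (t (i + 1 - int r))\<^sup>2)"
  have m': "real m \<noteq> 0" "real m - 1 > 0"
    using m by auto
  have "theta2 t m i = 1 / (real m * (real m - 1)) *
      (2 * (\<Sum>r = 1..m. \<Sum>s \<in> {r<..m}. t (i + 1 - int r) * t (i + 1 - int s)))"
    by (simp add: theta2_def)
  also have "\<dots> = (S\<^sup>2 - Q) / (real m * (real m - 1))"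
    unfolding two_sum_pairs by (simp add: S_def Q_def)
  finally have "theta2_bar t m i = (S / real m)\<^sup>2 - (S\<^sup>2 - Q) / (real m * (real m - 1))"
    by (simp add: theta2_bar_def theta_def S_def)
  also have "\<dots> = (real m * Q - S\<^sup>2) / ((real m)\<^sup>2 * (real m - 1))"
    using m' by (simp add: divide_simps power2_eq_square) (simp add: algebra_simps)
  finally have eq: "theta2_bar t m i = (real m * Q - S\<^sup>2) / ((real m)\<^sup>2 * (real m - 1))" .
  have "S\<^sup>2 \<le> Q * real m"
    using sum_squared_le_sum_of_squares[of "\<lambda>r. t (i + 1 - int r)" "{1..m}"]
    by (simp add: S_def Q_def mult.commute)
  with m' show ?thesis
    unfolding eq by (simp add: mult.commute)
qed

lemma sum_a_star:
  assumes "p > 0"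
  shows "(\<Sum>s = - int p..int p. a_star t m p i s * g s) =
         a_star t m p i (- int p) * g (- int p) + a_star t m p i 0 * g 0
         + a_star t m p i (int p) * g (int p)"
proof -
  have "(\<Sum>s = - int p..int p. a_star t m p i s * g s) =
        (\<Sum>s \<in> {- int p, 0, int p}. a_star t m p i s * g s)"
    using assms by (intro sum.mono_neutral_right) (auto simp: a_star_def Let_def)
  with assms show ?thesis by simp
qed

text \<open>The weights of the second divided difference annihilate \<open>1\<close> and \<open>x\<close> and send \<open>x\<^sup>2\<close>
  to \<open>1\<close>.\<close>

lemma three_point_moments:
  fixes u v w d :: real
  assumes "u < v" "v < w"
  defines "A \<equiv> - d / ((w - u) * (v - u))" and "B \<equiv> 1 + d / ((w - v) * (v - u))"
    and "C \<equiv> - d / ((w - u) * (w - v))"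
  shows "A + B + C = 1" and "A * u + B * v + C * w = v"
    and "A * u\<^sup>2 + B * v\<^sup>2 + C * w\<^sup>2 = v\<^sup>2 - d"
proof -
  have nz: "w - u \<noteq> 0" "v - u \<noteq> 0" "w - v \<noteq> 0"
    using assms(1,2) by auto
  define c where "c = d / ((w - u) * (v - u) * (w - v))"
  have A: "A = - c * (w - v)" and B: "B = 1 + c * (w - u)" and C: "C = - c * (v - u)"
    and d: "d = c * ((w - u) * (v - u) * (w - v))"
    using nz by (simp_all add: A_def B_def C_def c_def)
  show "A + B + C = 1" "A * u + B * v + C * w = v"
    by (simp_all add: A B C algebra_simps)
  show "A * u\<^sup>2 + B * v\<^sup>2 + C * w\<^sup>2 = v\<^sup>2 - d"
    unfolding A B C by (subst d) (simp add: algebra_simps power2_eq_square)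
qed

lemma feasible_a_star:
  assumes mono: "strict_mono (theta t m)" and p: "p > 0"
  shows "feasible t m p i (a_star t m p i)"
proof -
  let ?u = "theta t m (i - int p)" and ?v = "theta t m i" and ?w = "theta t m (i + int p)"
  have lt: "?u < ?v" "?v < ?w"
    using mono p by (simp_all add: strict_mono_less)
  have entries: "a_star t m p i (- int p) = - theta2_bar t m i / ((?w - ?u) * (?v - ?u))"
    "a_star t m p i 0 = 1 + theta2_bar t m i / ((?w - ?v) * (?v - ?u))"
    "a_star t m p i (int p) = - theta2_bar t m i / ((?w - ?u) * (?w - ?v))"
    using p by (simp_all add: a_star_def Let_def)
  have moment: "(\<Sum>s = - int p..int p. V t m i r s * a_star t m p i s) =
      a_star t m p i (- int p) * ?u ^ r + a_star t m p i 0 * ?v ^ r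
      + a_star t m p i (int p) * ?w ^ r" for r
    using sum_a_star[OF p, of t m i "\<lambda>s. theta t m (i + s) ^ r"]
    by (simp add: V_def mult.commute)
  have "a_star t m p i \<in> vecs p"
    using p by (auto simp: vecs_def a_star_def Let_def)
  moreover have "(\<Sum>s = - int p..int p. V t m i r s * a_star t m p i s) = b t m i r"
    if "r \<in> {0, 1, 2}" for r
    using that three_point_moments[OF lt, of "theta2_bar t m i"]
    unfolding moment entries by (auto simp: b_def theta2_bar_def)
  ultimately show ?thesis
    by (simp add: feasible_def)
qed

text \<open>The parabola through \<open>(u, -1)\<close>, \<open>(v, 1)\<close>, \<open>(w, -1)\<close> is bounded by \<open>1\<close> at the points of
  \<open>{u..w}\<close> that are at least as far from its axis as \<open>v\<close>: the difference \<open>1 - q x\<close> is a positive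
  multiple of \<open>(x - v) * (x + v - (u + w))\<close>.\<close>

lemma parabola_bound:
  fixes u v w x :: real
  assumes "u < v" "v < w" and "u \<le> x" "x \<le> w"
    and far: "(x - v) * (x + v - (u + w)) \<ge> 0"
  shows "\<bar>2 * ((x - u) * (w - x)) / ((v - u) * (w - v)) - 1\<bar> \<le> 1"
proof -
  have pos: "(v - u) * (w - v) > 0" and nonneg: "(x - u) * (w - x) \<ge> 0"
    using assms(1-4) by simp_all
  have "(x - u) * (w - x) \<le> (v - u) * (w - v)"
    using far by (simp add: algebra_simps)
  then have "(x - u) * (w - x) / ((v - u) * (w - v)) \<le> 1"
    using pos by simp
  moreover have "(x - u) * (w - x) / ((v - u) * (w - v)) \<ge> 0"
    using pos nonneg by simp
  ultimately show ?thesis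
    unfolding times_divide_eq_right[symmetric] by linarith
qed

lemma optimal_a_star:
  assumes mono: "strict_mono (theta t m)" and m: "m \<ge> 2" and p: "p > 0"
    and cond: "knot_condition t m p"
  shows "optimal t m p i (a_star t m p i)"
proof -
  let ?\<theta> = "theta t m"
  define u v w where uvw: "u = ?\<theta> (i - int p)" "v = ?\<theta> i" "w = ?\<theta> (i + int p)"
  have lt: "u < v" "v < w"
    using mono p by (simp_all add: uvw strict_mono_less)
  define q where "q = smult (2 / ((v - u) * (w - v))) ([:- u, 1:] * [:w, - 1:]) - 1"
  have q_eq: "poly q x = 2 * ((x - u) * (w - x)) / ((v - u) * (w - v)) - 1" for x
    by (simp only: q_def poly_diff poly_smult poly_mult poly_pCons poly_0 poly_1) simp
  have q_values: "poly q u = - 1" "poly q v = 1" "poly q w = - 1"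
    using lt by (simp_all add: q_eq)
  have d: "theta2_bar t m i \<ge> 0"
    using theta2_bar_nonneg[OF m] .
  show ?thesis
  proof (rule optimal_if_dual_certificate)
    show "feasible t m p i (a_star t m p i)"
      using mono p by (rule feasible_a_star)
    show "degree q \<le> 2"
      unfolding q_def by (intro degree_diff_le order.trans[OF degree_smult_le]) simp_all
  next
    fix s assume s: "s \<in> {- int p..int p}"
    have between: "u \<le> ?\<theta> (i + s)" "?\<theta> (i + s) \<le> w"
      using s mono by (simp_all add: uvw strict_mono_less_eq)
    have cond': "?\<theta> (i - 1) + v \<le> u + w" "u + w \<le> v + ?\<theta> (i + 1)"
      using cond by (simp_all add: knot_condition_def uvw)
    have "(?\<theta> (i + s) - v) * (?\<theta> (i + s) + v - (u + w)) \<ge> 0"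
    proof -
      consider "s = 0" | "s \<ge> 1" | "s \<le> - 1" by linarith
      then show ?thesis
      proof cases
        case 1
        then show ?thesis by (simp add: uvw)
      next
        case 2
        then have "v \<le> ?\<theta> (i + s)" "?\<theta> (i + 1) \<le> ?\<theta> (i + s)"
          using mono by (simp_all add: uvw strict_mono_less_eq)
        with cond' show ?thesis
          by (intro mult_nonneg_nonneg) linarith+
      next
        case 3
        then have "?\<theta> (i + s) \<le> v" "?\<theta> (i + s) \<le> ?\<theta> (i - 1)"
          using mono by (simp_all add: uvw strict_mono_less_eq)
        with cond' show ?thesis
          by (intro mult_nonpos_nonpos) linarith+
      qed
    qed
    then show "\<bar>poly q (?\<theta> (i + s))\<bar> \<le> 1"
      unfolding q_eq using parabola_bound[OF lt between] by blast
    have signs: "a_star t m p i (- int p) \<le> 0" "a_star t m p i 0 \<ge> 0" "a_star t m p i (int p) \<le> 0"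
      using lt d p by (simp_all add: a_star_def Let_def uvw[symmetric] divide_nonpos_pos)
    consider "s = - int p" | "s = 0" | "s = int p" | "s \<notin> {- int p, 0, int p}" by blast
    then show "a_star t m p i s * poly q (?\<theta> (i + s)) = \<bar>a_star t m p i s\<bar>"
    proof cases
      case 1
      then show ?thesis using signs q_values by (simp add: uvw)
    next
      case 2
      then show ?thesis using signs q_values by (simp add: uvw)
    next
      case 3
      then show ?thesis using signs q_values by (simp add: uvw)
    next
      case 4
      then show ?thesis by (simp add: a_star_def Let_def)
    qed
  qed
qed

lemma Q_star_eq_quasi_interpolant:
  assumes "p > 0"
  shows "Q_star t m p = quasi_interpolant t m p (a_star t m p)"
  by (intro ext) (simp add: Q_star_def quasi_interpolant_def sum_a_star[OF assms])

theorem theorem5: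
  fixes t :: "int \<Rightarrow> real" and m :: nat
  assumes "knot_sequence t" and "m \<ge> 2"
  shows "(\<forall>p. 2 * p \<ge> m \<longrightarrow> knot_condition t m p \<longrightarrow>
            (\<forall>i. optimal t m p i (a_star t m p i)))
       \<and> (\<forall>p. p \<ge> m \<longrightarrow> knot_condition t m p \<longrightarrow>
            near_best t m p (a_star t m p) (Q_star t m p))"
proof (intro conjI allI impI)
  have mono: "strict_mono (theta t m)"
    using assms by (intro strict_mono_theta) (auto simp: knot_sequence_def)
  show "optimal t m p i (a_star t m p i)" if "2 * p \<ge> m" "knot_condition t m p" for p i
    using that assms(2) by (intro optimal_a_star[OF mono]) auto
  show "near_best t m p (a_star t m p) (Q_star t m p)" if "p \<ge> m" "knot_condition t m p" for p
  proof -
    have p: "p > 0"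
      using that(1) assms(2) by simp
    show ?thesis
      unfolding near_best_def Q_star_eq_quasi_interpolant[OF p]
      using feasible_imp_reproduces_quadratics[OF assms feasible_a_star[OF mono p]]
        optimal_a_star[OF mono assms(2) p that(2)]
      by simp
  qed
qed

end
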